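(* Let $H$ be a complex Hilbert space with open unit ball $B_H$, and let $\varphi:B_H\to B_H$ be analytic (holomorphic) such that $\varphi(B_H)\subseteq rB_H$ for some $0<r<1$. Then, for the unique $a\in B_H$ such that $\varphi(a)=a$, we have $C_{\varphi^n}\to C_a$ as $n\to\infty$ in the norm of $L(H^\infty(B_H))$. In particular, $(C_\varphi)_{[n]}\to C_a$, and $C_\varphi:H^\infty(B_H)\to H^\infty(B_H)$ is uniformly mean ergodic.
   Context: A function is holomorphic (analytic) if it is (complex) Fréchet differentiable at every point. $H^\infty(B_H)$ is the Banach space of all bounded holomorphic functions $f:B_H\to\mathbb{C}$ with norm $\|f\|_\infty=\sup_{x\in B_H}|f(x)|$. $C_\psi(f)=f\circ\psi$ denotes the composition operator with symbol $\psi$, $\varphi^n$ is the $n$-th iterate of $\varphi$, and for $a\in B_H$, $C_a$ is the composition operator whose symbol is the constant function $a$, i.e. $C_a(f)$ is the constant function $f(a)$. A map $\varphi$ as in the claim has a unique fixed point in $B_H$ by the Earle–Hamilton fixed point theorem. For a Banach space $E$, $L(E)$ is the space of continuous linear maps $E\to E$ and, for $T\in L(E)$, $T_{[n]}=\frac1n\sum_{k=0}^{n-1}T^k$ ($T^0=\mathrm{id}$). $T$ is uniformly mean ergodic if $(T_{[n]})_n$ converges in $L(E)$ uniformly on bounded subsets of $E$, i.e. in operator norm. *)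

theory Defs
  imports "HOL-Analysis.Analysis"
begin

section \<open>Complex normed spaces and complex Hilbert spaces\<close>

class complex_normed_vector = real_normed_vector +
  fixes scaleC :: "complex \<Rightarrow> 'a \<Rightarrow> 'a"  (infixr "*\<^sub>C" 75)
  assumes scaleC_add_right: "c *\<^sub>C (x + y) = c *\<^sub>C x + c *\<^sub>C y"
    and scaleC_add_left: "(c + d) *\<^sub>C x = c *\<^sub>C x + d *\<^sub>C x"
    and scaleC_scaleC: "c *\<^sub>C d *\<^sub>C x = (c * d) *\<^sub>C x"
    and scaleR_scaleC: "r *\<^sub>R x = complex_of_real r *\<^sub>C x"
    and norm_scaleC: "norm (c *\<^sub>C x) = cmod c * norm x"

text \<open>The inner product is linear in its first argument. Positive definiteness is contained
  in the last axiom, which also says that the norm is the one induced by the inner product.\<close>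

class complex_hilbert_space = complex_normed_vector + banach +
  fixes cinner :: "'a \<Rightarrow> 'a \<Rightarrow> complex"
  assumes cinner_commute: "cinner x y = cnj (cinner y x)"
    and cinner_add_left: "cinner (x + y) z = cinner x z + cinner y z"
    and cinner_scaleC_left: "cinner (c *\<^sub>C x) y = c * cinner x y"
    and cinner_self: "cinner x x = complex_of_real ((norm x)\<^sup>2)"

instantiation complex :: complex_hilbert_space
begin

definition scaleC_complex :: "complex \<Rightarrow> complex \<Rightarrow> complex"
  where "scaleC_complex c x = c * x"

definition cinner_complex :: "complex \<Rightarrow> complex \<Rightarrow> complex"
  where "cinner_complex x y = x * cnj y"

instance
  by standard
    (auto simp: scaleC_complex_def cinner_complex_def algebra_simps scaleR_conv_of_real
      norm_mult simp flip: complex_norm_square)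

end


section \<open>Holomorphic maps\<close>

text \<open>\<open>has_derivative\<close> provides a bounded real-linear derivative; the second conjunct makes it
  complex-linear.\<close>

definition frechet_holomorphic_on ::
  "('a::complex_normed_vector \<Rightarrow> 'b::complex_normed_vector) \<Rightarrow> 'a set \<Rightarrow> bool"
  where "frechet_holomorphic_on f S \<longleftrightarrow>
    (\<forall>x\<in>S. \<exists>D. (f has_derivative D) (at x) \<and> (\<forall>c h. D (c *\<^sub>C h) = c *\<^sub>C D h))"

lemma frechet_holomorphic_on_const: "frechet_holomorphic_on (\<lambda>_. a) S"
proof -
  have "c *\<^sub>C (0::'b::complex_normed_vector) = 0" for c
    using norm_scaleC[of c "0::'b"] by simp
  then show ?thesis
    unfolding frechet_holomorphic_on_def by (auto intro!: exI[of _ "\<lambda>_. 0"])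
qed

lemma frechet_holomorphic_on_compose:
  assumes "frechet_holomorphic_on f S" "frechet_holomorphic_on g T" "f ` S \<subseteq> T"
  shows "frechet_holomorphic_on (\<lambda>x. g (f x)) S"
  unfolding frechet_holomorphic_on_def
proof
  fix x assume x: "x \<in> S"
  obtain D where D: "(f has_derivative D) (at x)" "\<And>c h. D (c *\<^sub>C h) = c *\<^sub>C D h"
    using assms(1) x unfolding frechet_holomorphic_on_def by blast
  obtain E where E: "(g has_derivative E) (at (f x))" "\<And>c h. E (c *\<^sub>C h) = c *\<^sub>C E h"
    using assms(2,3) x unfolding frechet_holomorphic_on_def by blast
  show "\<exists>D. ((\<lambda>x. g (f x)) has_derivative D) (at x) \<and> (\<forall>c h. D (c *\<^sub>C h) = c *\<^sub>C D h)"
    using diff_chain_at[OF D(1) E(1)] D(2) E(2)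
    by (intro exI[of _ "E \<circ> D"]) (simp add: o_def)
qed

lemma frechet_holomorphic_on_cong:
  assumes "frechet_holomorphic_on f S" "open S" "\<And>x. x \<in> S \<Longrightarrow> f x = g x"
  shows "frechet_holomorphic_on g S"
  using assms has_derivative_transform_within_open unfolding frechet_holomorphic_on_def by metis

lemma frechet_holomorphic_on_add:
  assumes "frechet_holomorphic_on f S" "frechet_holomorphic_on g S"
  shows "frechet_holomorphic_on (\<lambda>x. f x + g x) S"
  unfolding frechet_holomorphic_on_def
proof
  fix x assume x: "x \<in> S"
  obtain D where D: "(f has_derivative D) (at x)" "\<And>c h. D (c *\<^sub>C h) = c *\<^sub>C D h"
    using assms(1) x unfolding frechet_holomorphic_on_def by blast
  obtain E where E: "(g has_derivative E) (at x)" "\<And>c h. E (c *\<^sub>C h) = c *\<^sub>C E h"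
    using assms(2) x unfolding frechet_holomorphic_on_def by blast
  show "\<exists>D. ((\<lambda>x. f x + g x) has_derivative D) (at x) \<and> (\<forall>c h. D (c *\<^sub>C h) = c *\<^sub>C D h)"
    using has_derivative_add[OF D(1) E(1)] D(2) E(2)
    by (intro exI[of _ "\<lambda>h. D h + E h"]) (simp add: scaleC_add_right)
qed

lemma frechet_holomorphic_on_cmult:
  fixes f :: "'a::complex_normed_vector \<Rightarrow> complex"
  assumes "frechet_holomorphic_on f S"
  shows "frechet_holomorphic_on (\<lambda>x. c * f x) S"
  unfolding frechet_holomorphic_on_def
proof
  fix x assume x: "x \<in> S"
  obtain D where D: "(f has_derivative D) (at x)" "\<And>c h. D (c *\<^sub>C h) = c *\<^sub>C D h"
    using assms(1) x unfolding frechet_holomorphic_on_def by blast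
  show "\<exists>D. ((\<lambda>x. c * f x) has_derivative D) (at x) \<and> (\<forall>c h. D (c *\<^sub>C h) = c *\<^sub>C D h)"
    using has_derivative_mult_right[OF D(1), of c] D(2)
    by (intro exI[of _ "\<lambda>h. c * D h"]) (simp add: scaleC_complex_def)
qed


section \<open>The space \<open>H\<^sup>\<infinity>(B\<^sub>H)\<close>\<close>

text \<open>Elements are functions on the open unit ball; they are represented by total functions that
  vanish outside the ball, so that equality is equality on the ball.\<close>

typedef (overloaded) 'a hinf =
  "{f :: 'a::complex_hilbert_space \<Rightarrow> complex. frechet_holomorphic_on f (ball 0 1) \<and>
      bounded (f ` ball 0 1) \<and> (\<forall>x. x \<notin> ball 0 1 \<longrightarrow> f x = 0)}"
  morphisms hinf_apply Abs_hinf
  by (rule exI[of _ "\<lambda>_. 0"]) (auto intro: frechet_holomorphic_on_const simp: bounded_def)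

setup_lifting type_definition_hinf

lemma hinf_holomorphic: "frechet_holomorphic_on (hinf_apply f) (ball 0 1)"
  using hinf_apply[of f] by simp

lemma hinf_bdd_above: "bdd_above ((\<lambda>x. cmod (hinf_apply f x)) ` ball 0 1)"
  using hinf_apply[of f] by (auto simp: bounded_iff bdd_above_def)

lemma hinf_eqI: "(\<And>x. x \<in> ball 0 1 \<Longrightarrow> hinf_apply f x = hinf_apply g x) \<Longrightarrow> f = g"
  by transfer (simp add: fun_eq_iff, metis)

instantiation hinf :: (complex_hilbert_space) complex_normed_vector
begin

lift_definition zero_hinf :: "'a hinf" is "\<lambda>_. 0"
  by (auto intro: frechet_holomorphic_on_const simp: bounded_def)

lift_definition scaleC_hinf :: "complex \<Rightarrow> 'a hinf \<Rightarrow> 'a hinf" is "\<lambda>c f x. c * f x"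
proof (intro conjI)
  fix c :: complex and f :: "'a \<Rightarrow> complex"
  assume f: "frechet_holomorphic_on f (ball 0 1) \<and> bounded (f ` ball 0 1) \<and>
    (\<forall>x. x \<notin> ball 0 1 \<longrightarrow> f x = 0)"
  show "frechet_holomorphic_on (\<lambda>x. c * f x) (ball 0 1)"
    using f by (simp add: frechet_holomorphic_on_cmult)
  show "bounded ((\<lambda>x. c * f x) ` ball 0 1)"
    using f bounded_linear_image[OF _ bounded_linear_mult_right[of c], of "f ` ball 0 1"]
    by (simp add: image_image)
  show "\<forall>x. x \<notin> ball 0 1 \<longrightarrow> c * f x = 0"
    using f by simp
qed

lift_definition plus_hinf :: "'a hinf \<Rightarrow> 'a hinf \<Rightarrow> 'a hinf" is "\<lambda>f g x. f x + g x"
  by (auto intro: frechet_holomorphic_on_add bounded_plus_comp)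

definition uminus_hinf :: "'a hinf \<Rightarrow> 'a hinf"
  where "uminus_hinf f = (-1) *\<^sub>C f"

definition minus_hinf :: "'a hinf \<Rightarrow> 'a hinf \<Rightarrow> 'a hinf"
  where "minus_hinf f g = f + - g"

definition scaleR_hinf :: "real \<Rightarrow> 'a hinf \<Rightarrow> 'a hinf"
  where "scaleR_hinf r f = complex_of_real r *\<^sub>C f"

definition norm_hinf :: "'a hinf \<Rightarrow> real"
  where "norm_hinf f = (SUP x\<in>ball 0 1. cmod (hinf_apply f x))"

definition dist_hinf :: "'a hinf \<Rightarrow> 'a hinf \<Rightarrow> real"
  where "dist_hinf f g = norm (f - g)"

definition sgn_hinf :: "'a hinf \<Rightarrow> 'a hinf"
  where "sgn_hinf f = inverse (norm f) *\<^sub>R f"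

definition uniformity_hinf :: "('a hinf \<times> 'a hinf) filter"
  where "uniformity_hinf = (INF e\<in>{0<..}. principal {(x, y). dist x y < e})"

definition open_hinf :: "'a hinf set \<Rightarrow> bool"
  where "open_hinf U \<longleftrightarrow> (\<forall>x\<in>U. eventually (\<lambda>(x', y). x' = x \<longrightarrow> y \<in> U) uniformity)"

instance
proof
  fix f g h :: "'a hinf" and c d :: complex and r s :: real
  have bound: "cmod (hinf_apply f x) \<le> norm f" if "x \<in> ball 0 1" for f :: "'a hinf" and x
    unfolding norm_hinf_def using that by (intro cSUP_upper hinf_bdd_above)
  have least: "norm f \<le> b" if "\<And>x. x \<in> ball 0 1 \<Longrightarrow> cmod (hinf_apply f x) \<le> b"
    for f :: "'a hinf" and b
    unfolding norm_hinf_def using that by (intro cSUP_least) auto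
  have zero_ball: "(0::'a) \<in> ball 0 1"
    by simp
  show "f + g + h = f + (g + h)"
    by transfer (simp add: add.assoc)
  show "f + g = g + f"
    by transfer (simp add: add.commute)
  show "0 + f = f"
    by transfer simp
  show "- f + f = 0"
    unfolding uminus_hinf_def by transfer simp
  show "f - g = f + - g"
    by (simp add: minus_hinf_def)
  show "r *\<^sub>R (f + g) = r *\<^sub>R f + r *\<^sub>R g"
    unfolding scaleR_hinf_def by transfer (simp add: algebra_simps)
  show "(r + s) *\<^sub>R f = r *\<^sub>R f + s *\<^sub>R f"
    unfolding scaleR_hinf_def by transfer (simp add: algebra_simps)
  show "r *\<^sub>R s *\<^sub>R f = (r * s) *\<^sub>R f"
    unfolding scaleR_hinf_def by transfer (simp add: algebra_simps)
  show "1 *\<^sub>R f = f"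
    unfolding scaleR_hinf_def by transfer simp
  show "dist f g = norm (f - g)"
    by (simp add: dist_hinf_def)
  show "sgn f = inverse (norm f) *\<^sub>R f"
    by (simp add: sgn_hinf_def)
  show "uniformity = (INF e\<in>{0<..}. principal {(x, y :: 'a hinf). dist x y < e})"
    by (simp add: uniformity_hinf_def)
  show "open U \<longleftrightarrow> (\<forall>x\<in>U. eventually (\<lambda>(x', y). x' = x \<longrightarrow> y \<in> U) uniformity)"
    for U :: "'a hinf set"
    by (simp add: open_hinf_def)
  show "norm f = 0 \<longleftrightarrow> f = 0"
  proof
    assume "norm f = 0"
    then have "hinf_apply f x = hinf_apply 0 x" if "x \<in> ball 0 1" for x
      using bound[OF that, of f] by (simp add: zero_hinf.rep_eq)
    then show "f = 0"
      by (rule hinf_eqI)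
  next
    assume "f = 0"
    then show "norm f = 0"
      using least[of f 0] bound[OF zero_ball, of f]
      by (simp add: zero_hinf.rep_eq)
  qed
  show "norm (f + g) \<le> norm f + norm g"
    by (rule least)
      (auto simp: plus_hinf.rep_eq intro!: norm_triangle_le add_mono bound)
  have scale_le: "norm (c *\<^sub>C f) \<le> cmod c * norm f" for c :: complex and f :: "'a hinf"
    by (rule least) (auto simp: scaleC_hinf.rep_eq norm_mult intro!: mult_left_mono bound)
  have scale: "norm (c *\<^sub>C f) = cmod c * norm f" for c :: complex and f :: "'a hinf"
  proof (cases "c = 0")
    case True
    have "0 \<le> norm (c *\<^sub>C f)"
      using bound[OF zero_ball, of "c *\<^sub>C f"] norm_ge_zero order_trans by blast
    with True scale_le[of c f] show ?thesis by simp
  next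
    case False
    have "inverse c *\<^sub>C c *\<^sub>C f = f"
      using False by transfer (simp add: fun_eq_iff)
    then have "norm f \<le> inverse (cmod c) * norm (c *\<^sub>C f)"
      using scale_le[of "inverse c" "c *\<^sub>C f"] by (simp add: norm_inverse)
    then have "cmod c * norm f \<le> norm (c *\<^sub>C f)"
      using False by (simp add: field_simps)
    with scale_le[of c f] show ?thesis by simp
  qed
  show "norm (r *\<^sub>R f) = \<bar>r\<bar> * norm f"
    unfolding scaleR_hinf_def using scale[of "complex_of_real r" f] by simp
  show "c *\<^sub>C (f + g) = c *\<^sub>C f + c *\<^sub>C g"
    by transfer (simp add: algebra_simps)
  show "(c + d) *\<^sub>C f = c *\<^sub>C f + d *\<^sub>C f"
    by transfer (simp add: algebra_simps)
  show "c *\<^sub>C d *\<^sub>C f = (c * d) *\<^sub>C f"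
    by transfer (simp add: algebra_simps)
  show "r *\<^sub>R f = complex_of_real r *\<^sub>C f"
    by (simp add: scaleR_hinf_def)
  show "norm (c *\<^sub>C f) = cmod c * norm f"
    by (rule scale)
qed

end

lemma hinf_norm_bound: "x \<in> ball 0 1 \<Longrightarrow> cmod (hinf_apply f x) \<le> norm f"
  unfolding norm_hinf_def by (intro cSUP_upper hinf_bdd_above)

lemma hinf_norm_least:
  "(\<And>x. x \<in> ball 0 1 \<Longrightarrow> cmod (hinf_apply f x) \<le> b) \<Longrightarrow> norm f \<le> b"
  unfolding norm_hinf_def by (intro cSUP_least) auto


section \<open>Operators on complex normed spaces\<close>

text \<open>The type \<open>'a \<Rightarrow>\<^sub>L 'a\<close> consists of the bounded real-linear maps; \<open>L(E)\<close> is its subset of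
  complex-linear maps, with the same (operator) norm.\<close>

definition complex_operators :: "('a::complex_normed_vector \<Rightarrow>\<^sub>L 'a) set"
  where "complex_operators = {T. \<forall>c x. blinfun_apply T (c *\<^sub>C x) = c *\<^sub>C blinfun_apply T x}"

primrec blinfun_power ::
  "('a::real_normed_vector \<Rightarrow>\<^sub>L 'a) \<Rightarrow> nat \<Rightarrow> ('a \<Rightarrow>\<^sub>L 'a)"
  where
    "blinfun_power T 0 = id_blinfun"
  | "blinfun_power T (Suc k) = T o\<^sub>L blinfun_power T k"

text \<open>The value at \<open>n = 0\<close> is the junk value \<open>0\<close>.\<close>

definition cesaro_mean ::
  "('a::real_normed_vector \<Rightarrow>\<^sub>L 'a) \<Rightarrow> nat \<Rightarrow> ('a \<Rightarrow>\<^sub>L 'a)"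
  where "cesaro_mean T n = (1 / real n) *\<^sub>R (\<Sum>k<n. blinfun_power T k)"

definition uniformly_mean_ergodic :: "('a::complex_normed_vector \<Rightarrow>\<^sub>L 'a) \<Rightarrow> bool"
  where "uniformly_mean_ergodic T \<longleftrightarrow>
    T \<in> complex_operators \<and> (\<exists>P\<in>complex_operators. cesaro_mean T \<longlonglongrightarrow> P)"


section \<open>Composition operators\<close>

text \<open>Meaningful for symbols that are holomorphic self-maps of the open unit ball, see
  \<open>composition_operator_apply\<close>. Only the values of the symbol on the ball matter.\<close>

definition composition_operator ::
  "('a::complex_hilbert_space \<Rightarrow> 'a) \<Rightarrow> 'a hinf \<Rightarrow>\<^sub>L 'a hinf"
  where "composition_operator \<psi> =
    Blinfun (\<lambda>f. Abs_hinf (\<lambda>x. if x \<in> ball 0 1 then hinf_apply f (\<psi> x) else 0))"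

context
  fixes \<psi> :: "'a::complex_hilbert_space \<Rightarrow> 'a"
  assumes hol: "frechet_holomorphic_on \<psi> (ball 0 1)"
    and self: "\<psi> ` ball 0 1 \<subseteq> ball 0 1"
begin

private lemma hinf_apply_compose:
  "hinf_apply (Abs_hinf (\<lambda>x. if x \<in> ball 0 1 then hinf_apply f (\<psi> x) else 0)) =
    (\<lambda>x. if x \<in> ball 0 1 then hinf_apply f (\<psi> x) else 0)"
proof (rule Abs_hinf_inverse, intro CollectI conjI)
  show "frechet_holomorphic_on (\<lambda>x. if x \<in> ball 0 1 then hinf_apply f (\<psi> x) else 0) (ball 0 1)"
    by (rule frechet_holomorphic_on_cong[OF
          frechet_holomorphic_on_compose[OF hol hinf_holomorphic self]]) auto
  show "bounded ((\<lambda>x. if x \<in> ball 0 1 then hinf_apply f (\<psi> x) else 0) ` ball 0 1)"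
    unfolding bounded_iff using self hinf_norm_bound[of _ f]
    by (intro exI[of _ "norm f"]) (simp add: image_subset_iff del: mem_ball_0 mem_ball)
qed auto

private lemma composition_operator_eq:
  "blinfun_apply (composition_operator \<psi>) =
    (\<lambda>f. Abs_hinf (\<lambda>x. if x \<in> ball 0 1 then hinf_apply f (\<psi> x) else 0))"
  unfolding composition_operator_def
proof (rule bounded_linear_Blinfun_apply, rule bounded_linear_intro[where K = 1])
  fix f g :: "'a hinf" and r :: real
  show "Abs_hinf (\<lambda>x. if x \<in> ball 0 1 then hinf_apply (f + g) (\<psi> x) else 0) =
      Abs_hinf (\<lambda>x. if x \<in> ball 0 1 then hinf_apply f (\<psi> x) else 0) +
      Abs_hinf (\<lambda>x. if x \<in> ball 0 1 then hinf_apply g (\<psi> x) else 0)"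
    by (rule hinf_eqI) (simp add: hinf_apply_compose plus_hinf.rep_eq del: mem_ball_0 mem_ball)
  show "Abs_hinf (\<lambda>x. if x \<in> ball 0 1 then hinf_apply (r *\<^sub>R f) (\<psi> x) else 0) =
      r *\<^sub>R Abs_hinf (\<lambda>x. if x \<in> ball 0 1 then hinf_apply f (\<psi> x) else 0)"
    by (rule hinf_eqI) (simp add: hinf_apply_compose scaleR_scaleC scaleC_hinf.rep_eq
        del: mem_ball_0 mem_ball)
  show "norm (Abs_hinf (\<lambda>x. if x \<in> ball 0 1 then hinf_apply f (\<psi> x) else 0)) \<le> norm f * 1"
  proof (intro hinf_norm_least)
    fix x :: 'a
    assume "x \<in> ball 0 1"
    then show "cmod (hinf_apply (Abs_hinf (\<lambda>x. if x \<in> ball 0 1 then hinf_apply f (\<psi> x) else 0)) x)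
        \<le> norm f * 1"
      using hinf_norm_bound[of "\<psi> x" f] self
      by (simp add: hinf_apply_compose image_subset_iff del: mem_ball_0 mem_ball)
  qed
qed

lemma composition_operator_apply:
  "x \<in> ball 0 1 \<Longrightarrow>
    hinf_apply (blinfun_apply (composition_operator \<psi>) f) x = hinf_apply f (\<psi> x)"
  by (simp add: composition_operator_eq hinf_apply_compose del: mem_ball_0 mem_ball)

lemma composition_operator_complex: "composition_operator \<psi> \<in> complex_operators"
  unfolding complex_operators_def
  by (auto intro!: hinf_eqI simp: composition_operator_apply scaleC_hinf.rep_eq)

end

end

theory Submission
  imports Defs "HOL-Complex_Analysis.Conformal_Mappings"
begin

text \<open>
  The proof follows the oscillation of a function on the ball, the supremum of
  \<open>\<bar>f x - f y\<bar>\<close> over all \<open>x, y\<close> in the ball. Composition with \<open>\<phi>\<close> multiplies it by at most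
  \<open>r\<close>: the values of \<open>\<phi>\<close> have the form \<open>r x\<close> with \<open>x\<close> in the ball, and
  \<open>z \<mapsto> f (z x) - f (z y)\<close> is a holomorphic function of \<open>z\<close> in the unit disc that vanishes at
  \<open>0\<close> and is bounded by the oscillation of \<open>f\<close>, so that the Schwarz lemma applies at \<open>z = r\<close>
  (\<open>oscillation_dilation\<close>). Hence the oscillation of \<open>f \<circ> \<phi>\<^sup>n\<close> is at most
  \<open>2 r\<^sup>n \<parallel>f\<parallel>\<close> (\<open>oscillation_funpow\<close>).

  Everything else is read off from this estimate. The functionals \<open>x \<mapsto> \<langle>x, u\<rangle>\<close> show that
  \<open>\<parallel>\<phi>\<^sup>n x - \<phi>\<^sup>n y\<parallel> \<le> 2 r\<^sup>n\<close>, which makes the orbit of \<open>0\<close> a Cauchy sequence whose limit is the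
  only fixed point. With \<open>y = a = \<phi>\<^sup>n a\<close>, the supremum over the unit ball of \<open>H\<^sup>\<infinity>\<close> yields
  \<open>\<parallel>C\<^bsub>\<phi>\<^sup>n\<^esub> - C\<^sub>a\<parallel> \<le> 2 r\<^sup>n\<close>. These bounds are summable, and so the Cesaro means
  converge at the rate \<open>1 / n\<close>.
\<close>

section \<open>Complex-linear maps and the inner product\<close>

lemma frechet_holomorphic_on_bounded_linear:
  assumes "bounded_linear D" "\<And>c x. D (c *\<^sub>C x) = c *\<^sub>C D x"
  shows "frechet_holomorphic_on D S"
  unfolding frechet_holomorphic_on_def
  using assms bounded_linear_imp_has_derivative[OF assms(1)] by blast

lemma frechet_holomorphic_on_imp_holomorphic_on:
  fixes f :: "complex \<Rightarrow> complex"
  assumes "frechet_holomorphic_on f S"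
  shows "f holomorphic_on S"
  unfolding holomorphic_on_def
proof
  fix z assume "z \<in> S"
  then obtain D where D: "(f has_derivative D) (at z)" "\<And>c h. D (c *\<^sub>C h) = c *\<^sub>C D h"
    using assms unfolding frechet_holomorphic_on_def by blast
  have "D = (*) (D 1)"
  proof
    fix c
    show "D c = D 1 * c"
      using D(2)[of c 1] unfolding scaleC_complex_def mult_1_right by (simp only: mult.commute)
  qed
  with D(1) have "(f has_field_derivative D 1) (at z)"
    by (simp add: has_field_derivative_def)
  then show "f field_differentiable at z within S"
    using field_differentiable_def field_differentiable_at_within by blast
qed

lemma frechet_holomorphic_on_imp_continuous_on:
  assumes "frechet_holomorphic_on f S"
  shows "continuous_on S f"
proof (rule continuous_at_imp_continuous_on, rule ballI)
  fix x assume "x \<in> S"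
  then obtain D where "(f has_derivative D) (at x)"
    using assms unfolding frechet_holomorphic_on_def by blast
  then show "isCont f x"
    by (rule has_derivative_continuous)
qed

lemma scaleC_zero_left [simp]: "0 *\<^sub>C x = (0 :: 'a :: complex_normed_vector)"
  using norm_scaleC[of 0 x] by simp

lemma bounded_linear_scaleC_left: "bounded_linear (\<lambda>c. c *\<^sub>C (x :: 'a :: complex_normed_vector))"
proof (rule bounded_linear_intro[where K = "norm x"])
  show "(r *\<^sub>R c) *\<^sub>C x = r *\<^sub>R (c *\<^sub>C x)" for r and c :: complex
    unfolding scaleR_scaleC[of r "c *\<^sub>C x"] scaleC_scaleC scaleR_conv_of_real by simp
qed (simp_all add: scaleC_add_left norm_scaleC)

text \<open>Expanding \<open>\<parallel>x + y\<parallel>\<^sup>2 \<le> (\<parallel>x\<parallel> + \<parallel>y\<parallel>)\<^sup>2\<close> bounds the real part of \<open>\<langle>x, y\<rangle>\<close>; multiplying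
  \<open>x\<close> by a unimodular scalar turns \<open>\<langle>x, y\<rangle>\<close> into its modulus.\<close>

lemma cmod_cinner_le:
  fixes x y :: "'a :: complex_hilbert_space"
  shows "cmod (cinner x y) \<le> norm x * norm y"
proof -
  have re: "Re (cinner x y) \<le> norm x * norm y" for x y :: 'a
  proof -
    have "cinner (x + y) (x + y) = cinner x x + cinner x y + cnj (cinner x y) + cinner y y"
      by (metis (no_types, opaque_lifting) add.assoc cinner_add_left cinner_commute complex_cnj_add)
    then have "(norm (x + y))\<^sup>2 = (norm x)\<^sup>2 + 2 * Re (cinner x y) + (norm y)\<^sup>2"
      unfolding cinner_self by (simp add: complex_eq_iff)
    moreover have "(norm (x + y))\<^sup>2 \<le> (norm x + norm y)\<^sup>2"
      by (simp add: norm_triangle_ineq power_mono)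
    ultimately show ?thesis
      by (simp add: power2_sum)
  qed
  show ?thesis
  proof (cases "cinner x y = 0")
    case False
    define c where "c = cnj (sgn (cinner x y))"
    have "cmod c = 1"
      using False by (simp add: c_def norm_sgn)
    moreover have "c * cinner x y = complex_of_real (cmod (cinner x y))"
      using False complex_norm_square[of "cinner x y"]
      by (simp add: c_def sgn_eq power2_eq_square mult.commute field_simps)
    ultimately show ?thesis
      using re[of "c *\<^sub>C x" y] by (simp add: cinner_scaleC_left norm_scaleC)
  qed simp
qed

lemma bounded_linear_cinner_left:
  "bounded_linear (\<lambda>x. cinner x (u :: 'a :: complex_hilbert_space))"
proof (rule bounded_linear_intro[where K = "norm u"])
  show "cinner (r *\<^sub>R x) u = r *\<^sub>R cinner x u" for r and x :: 'a
    unfolding scaleR_scaleC[of r x] cinner_scaleC_left scaleR_conv_of_real by simp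
qed (simp_all add: cinner_add_left cmod_cinner_le)

section \<open>Oscillation of holomorphic functions on the ball\<close>

text \<open>The Schwarz lemma for the closed bound \<open>M\<close>, which may be \<open>0\<close>: scaling by any larger bound
  \<open>M + e\<close> produces a self-map of the open disc.\<close>

lemma Schwarz_bound:
  assumes h: "h holomorphic_on ball 0 1" "h 0 = 0"
    and le: "\<And>z. cmod z < 1 \<Longrightarrow> cmod (h z) \<le> M" and z: "cmod z < 1"
  shows "cmod (h z) \<le> M * cmod z"
proof (rule field_le_epsilon)
  fix e :: real assume e: "0 < e"
  have M: "0 \<le> M"
    using le[of 0] h(2) by simp
  have "cmod (h z / complex_of_real (M + e)) \<le> cmod z"
  proof (rule Schwarz_Lemma(1)[OF _ _ _ z])
    show "(\<lambda>z. h z / complex_of_real (M + e)) holomorphic_on ball 0 1"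
      using M e by (intro holomorphic_intros h) (simp flip: of_real_add)
    show "cmod (h w / complex_of_real (M + e)) < 1" if "cmod w < 1" for w
      using le[OF that] M e by (simp add: norm_divide flip: of_real_add)
  qed (simp add: h)
  then have "cmod (h z) \<le> cmod z * (M + e)"
    using M e by (simp add: norm_divide divide_le_eq flip: of_real_add)
  also have "\<dots> \<le> M * cmod z + e"
    using z e by (simp add: algebra_simps mult_left_le)
  finally show "cmod (h z) \<le> M * cmod z + e" .
qed

text \<open>On the slice \<open>z \<mapsto> z u\<close> of the unit disc through a point \<open>u\<close> of the ball, \<open>f\<close> is a
  holomorphic function of one variable. The slices through \<open>x\<close> and \<open>y\<close> meet at \<open>z = 0\<close>, so the
  difference of the two functions satisfies the hypotheses of the Schwarz lemma.\<close>

lemma oscillation_dilation: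
  fixes f :: "'a :: complex_hilbert_space \<Rightarrow> complex"
  assumes f: "frechet_holomorphic_on f (ball 0 1)"
    and osc: "\<And>x y. x \<in> ball 0 1 \<Longrightarrow> y \<in> ball 0 1 \<Longrightarrow> cmod (f x - f y) \<le> M"
    and r: "0 \<le> r" "r < 1" and x: "x \<in> ball 0 1" and y: "y \<in> ball 0 1"
  shows "cmod (f (r *\<^sub>R x) - f (r *\<^sub>R y)) \<le> r * M"
proof -
  define h where "h z = f (z *\<^sub>C x) + (-1) * f (z *\<^sub>C y)" for z
  have disc: "z *\<^sub>C u \<in> ball 0 1" if "cmod z < 1" "u \<in> ball 0 1" for z and u :: 'a
    using that mult_strict_mono[of "cmod z" 1 "norm u" 1] by (simp add: norm_scaleC)
  have line: "frechet_holomorphic_on (\<lambda>z. f (z *\<^sub>C u)) (ball 0 1)" if "u \<in> ball 0 1" for u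
  proof (rule frechet_holomorphic_on_compose[OF _ f])
    show "frechet_holomorphic_on (\<lambda>z. z *\<^sub>C u) (ball 0 1)"
      by (rule frechet_holomorphic_on_bounded_linear[OF bounded_linear_scaleC_left])
        (simp add: scaleC_scaleC scaleC_complex_def)
  qed (use disc that in auto)
  have "frechet_holomorphic_on h (ball 0 1)"
    unfolding h_def
    by (intro frechet_holomorphic_on_add frechet_holomorphic_on_cmult line x y)
  then have "h holomorphic_on ball 0 1"
    by (rule frechet_holomorphic_on_imp_holomorphic_on)
  moreover have "h 0 = 0"
    by (simp add: h_def)
  moreover have "cmod (h z) \<le> M" if "cmod z < 1" for z
    using osc[OF disc[OF that x] disc[OF that y]] by (simp add: h_def)
  ultimately have "cmod (h (complex_of_real r)) \<le> M * cmod (complex_of_real r)"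
    using r by (intro Schwarz_bound) auto
  then show ?thesis
    using r by (simp add: h_def scaleR_scaleC mult.commute)
qed

lemma funpow_in_invariant_set:
  assumes "\<phi> ` S \<subseteq> S" "x \<in> S"
  shows "(\<phi> ^^ n) x \<in> S"
  by (induction n) (use assms in \<open>simp_all add: image_subset_iff\<close>)

lemma funpow_fixpoint:
  assumes "f a = a"
  shows "(f ^^ n) a = a"
  by (induction n) (simp_all add: assms)

lemma frechet_holomorphic_on_funpow:
  assumes "frechet_holomorphic_on \<phi> S" "\<phi> ` S \<subseteq> S"
  shows "frechet_holomorphic_on (\<phi> ^^ n) S"
proof (induction n)
  case 0
  show ?case
    using frechet_holomorphic_on_bounded_linear[OF bounded_linear_ident, of S] by (simp add: id_def)
next
  case (Suc n)
  have "(\<phi> ^^ n) ` S \<subseteq> S"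
    using funpow_in_invariant_set[OF assms(2)] by auto
  from frechet_holomorphic_on_compose[OF Suc assms(1) this] show ?case
    by (simp add: o_def)
qed

text \<open>The induction adds one copy of \<open>\<phi>\<close> on the inside: its values lie in the dilated ball, and
  \<open>oscillation_dilation\<close> applies to the function \<open>f \<circ> \<phi>\<^sup>n\<close>, whose oscillation on the whole ball
  is already bounded by \<open>r\<^sup>n M\<close>.\<close>

lemma oscillation_funpow:
  fixes f :: "'a :: complex_hilbert_space \<Rightarrow> complex" and \<phi> :: "'a \<Rightarrow> 'a"
  assumes f: "frechet_holomorphic_on f (ball 0 1)"
    and osc: "\<And>x y. x \<in> ball 0 1 \<Longrightarrow> y \<in> ball 0 1 \<Longrightarrow> cmod (f x - f y) \<le> M"
    and \<phi>: "frechet_holomorphic_on \<phi> (ball 0 1)" "\<phi> ` ball 0 1 \<subseteq> ball 0 1"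
    and r: "0 \<le> r" "r < 1" and dil: "\<phi> ` ball 0 1 \<subseteq> (\<lambda>x. r *\<^sub>R x) ` ball 0 1"
    and "x \<in> ball 0 1" "y \<in> ball 0 1"
  shows "cmod (f ((\<phi> ^^ n) x) - f ((\<phi> ^^ n) y)) \<le> r ^ n * M"
  using assms(8,9)
proof (induction n arbitrary: x y)
  case 0
  then show ?case
    using osc[of x y] by simp
next
  case (Suc n)
  obtain x' where x': "\<phi> x = r *\<^sub>R x'" "x' \<in> ball 0 1"
    using subsetD[OF dil imageI[OF Suc.prems(1)]] by (rule imageE)
  obtain y' where y': "\<phi> y = r *\<^sub>R y'" "y' \<in> ball 0 1"
    using subsetD[OF dil imageI[OF Suc.prems(2)]] by (rule imageE)
  have "frechet_holomorphic_on (\<lambda>x. f ((\<phi> ^^ n) x)) (ball 0 1)"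
    by (rule frechet_holomorphic_on_compose[OF frechet_holomorphic_on_funpow[OF \<phi>] f])
      (use funpow_in_invariant_set[OF \<phi>(2)] in auto)
  from oscillation_dilation[OF this Suc.IH r x'(2) y'(2)] show ?case
    by (simp add: funpow_Suc_right x'(1) y'(1) mult.assoc del: funpow.simps)
qed

section \<open>The fixed point\<close>

text \<open>The functional \<open>\<langle>\<cdot>, u\<rangle>\<close> has oscillation at most \<open>2 \<parallel>u\<parallel>\<close>; it is applied to
  \<open>u = \<phi>\<^sup>n x - \<phi>\<^sup>n y\<close> itself.\<close>

lemma dist_funpow_le:
  fixes \<phi> :: "'a :: complex_hilbert_space \<Rightarrow> 'a"
  assumes \<phi>: "frechet_holomorphic_on \<phi> (ball 0 1)" "\<phi> ` ball 0 1 \<subseteq> ball 0 1"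
    and r: "0 \<le> r" "r < 1" and dil: "\<phi> ` ball 0 1 \<subseteq> (\<lambda>x. r *\<^sub>R x) ` ball 0 1"
    and x: "x \<in> ball 0 1" and y: "y \<in> ball 0 1"
  shows "norm ((\<phi> ^^ n) x - (\<phi> ^^ n) y) \<le> 2 * r ^ n"
proof -
  define u where "u = (\<phi> ^^ n) x - (\<phi> ^^ n) y"
  interpret L: bounded_linear "\<lambda>x. cinner x u"
    by (rule bounded_linear_cinner_left)
  have osc: "cmod (cinner v u - cinner w u) \<le> 2 * norm u" if "v \<in> ball 0 1" "w \<in> ball 0 1" for v w
  proof -
    have "norm (v - w) \<le> 2"
      using that norm_triangle_ineq4[of v w] by simp
    then show ?thesis
      using cmod_cinner_le[of "v - w" u] mult_right_mono[of "norm (v - w)" 2 "norm u"]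
      by (simp add: L.diff)
  qed
  have "cmod (cinner ((\<phi> ^^ n) x) u - cinner ((\<phi> ^^ n) y) u) \<le> r ^ n * (2 * norm u)"
    by (rule oscillation_funpow[OF _ osc \<phi> r dil x y])
      (auto intro: frechet_holomorphic_on_bounded_linear bounded_linear_cinner_left
        simp: cinner_scaleC_left scaleC_complex_def)
  also have "cinner ((\<phi> ^^ n) x) u - cinner ((\<phi> ^^ n) y) u = complex_of_real ((norm u)\<^sup>2)"
    unfolding L.diff[symmetric] cinner_self[symmetric] by (simp add: u_def)
  finally have "norm u * norm u \<le> (2 * r ^ n) * norm u"
    by (simp add: power2_eq_square mult_ac norm_mult)
  then show ?thesis
    using r by (cases "u = 0") (auto simp: u_def)
qed

text \<open>The limit of the orbit of \<open>0\<close> stays inside the open ball, where \<open>\<phi>\<close> is continuous, because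
  all values of \<open>\<phi>\<close> have norm at most \<open>r < 1\<close>.\<close>

lemma ex1_fixed_point:
  fixes \<phi> :: "'a :: complex_hilbert_space \<Rightarrow> 'a"
  assumes \<phi>: "frechet_holomorphic_on \<phi> (ball 0 1)" "\<phi> ` ball 0 1 \<subseteq> ball 0 1"
    and r: "0 \<le> r" "r < 1" and dil: "\<phi> ` ball 0 1 \<subseteq> (\<lambda>x. r *\<^sub>R x) ` ball 0 1"
  shows "\<exists>!a. a \<in> ball 0 1 \<and> \<phi> a = a"
proof -
  have small: "(\<lambda>n. 2 * r ^ n) \<longlonglongrightarrow> 0"
    using tendsto_mult_right_zero[OF LIMSEQ_power_zero[of r]] r by simp
  define s where "s n = (\<phi> ^^ n) 0" for n
  have s_ball: "s n \<in> ball 0 1" for n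
    unfolding s_def by (rule funpow_in_invariant_set[OF \<phi>(2)]) simp
  have s_add: "norm (s (n + k) - s n) \<le> 2 * r ^ n" for n k
    using dist_funpow_le[OF assms s_ball[of k], of 0 n] by (simp add: s_def funpow_add)
  have "Cauchy s"
  proof (rule metric_CauchyI)
    fix e :: real assume "0 < e"
    then obtain N where "2 * r ^ N < e / 2"
      using order_tendstoD(2)[OF small, of "e / 2"] by (auto simp: eventually_sequentially)
    then have "dist (s n) (s N) < e / 2" if "n \<ge> N" for n
      using s_add[of N "n - N"] that by (simp add: dist_norm)
    then show "\<exists>M. \<forall>m\<ge>M. \<forall>n\<ge>M. dist (s m) (s n) < e"
      by (meson dist_triangle_half_l)
  qed
  then obtain a where a: "s \<longlonglongrightarrow> a"
    using Cauchy_convergent_iff convergent_def by blast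
  have s_Suc: "s (Suc n) = \<phi> (s n)" for n
    by (simp add: s_def)
  have "norm (s (Suc n)) \<le> r" for n
  proof -
    obtain x where "x \<in> ball 0 1" "s (Suc n) = r *\<^sub>R x"
      using dil s_ball[of n] by (force simp: s_Suc)
    then show ?thesis
      using r by (simp add: mult_left_le)
  qed
  then have "norm a \<le> r"
    using LIMSEQ_le_const2[OF tendsto_norm[OF LIMSEQ_Suc[OF a]]] by blast
  with r have a_ball: "a \<in> ball 0 1"
    by simp
  have "(\<lambda>n. \<phi> (s n)) \<longlonglongrightarrow> \<phi> a"
    using continuous_on_tendsto_compose[OF frechet_holomorphic_on_imp_continuous_on[OF \<phi>(1)] a a_ball]
      s_ball by simp
  with LIMSEQ_Suc[OF a] have "\<phi> a = a"
    unfolding s_Suc using LIMSEQ_unique by blast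
  moreover have "b = c" if "b \<in> ball 0 1" "\<phi> b = b" "c \<in> ball 0 1" "\<phi> c = c" for b c
  proof -
    have "norm (b - c) \<le> 2 * r ^ n" for n
      using dist_funpow_le[OF assms that(1,3), of n] that(2,4) by (simp add: funpow_fixpoint)
    with small have "norm (b - c) \<le> 0"
      by (meson LIMSEQ_le_const)
    then show ?thesis by simp
  qed
  ultimately show ?thesis
    using a_ball by blast
qed

section \<open>Convergence of the composition operators\<close>

lemma blinfun_power_composition_operator:
  assumes \<phi>: "frechet_holomorphic_on \<phi> (ball 0 1)" "\<phi> ` ball 0 1 \<subseteq> ball 0 1"
  shows "blinfun_power (composition_operator \<phi>) n = composition_operator (\<phi> ^^ n)"
proof (induction n)
  case 0
  have "frechet_holomorphic_on (\<phi> ^^ 0) (ball 0 1)" "(\<phi> ^^ 0) ` ball 0 1 \<subseteq> ball 0 1"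
    using frechet_holomorphic_on_funpow[OF \<phi>, of 0] by simp_all
  from composition_operator_apply[OF this] show ?case
    by (intro blinfun_eqI hinf_eqI) (simp add: id_def)
next
  case (Suc n)
  have self: "(\<phi> ^^ k) ` ball 0 1 \<subseteq> ball 0 1" for k
    using funpow_in_invariant_set[OF \<phi>(2)] by blast
  note app = composition_operator_apply[OF frechet_holomorphic_on_funpow[OF \<phi>] self]
  show ?case
  proof (rule blinfun_eqI, rule hinf_eqI)
    fix f :: "'a hinf" and x :: 'a
    assume x: "x \<in> ball 0 1"
    then have "\<phi> x \<in> ball 0 1"
      using \<phi>(2) by blast
    then have "hinf_apply (blinfun_power (composition_operator \<phi>) (Suc n) f) x
        = hinf_apply f ((\<phi> ^^ n) (\<phi> x))"
      using x by (simp add: Suc app composition_operator_apply[OF \<phi>] del: mem_ball mem_ball_0)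
    also have "\<dots> = hinf_apply f ((\<phi> ^^ Suc n) x)"
      by (simp add: funpow_swap1)
    also have "\<dots> = hinf_apply (composition_operator (\<phi> ^^ Suc n) f) x"
      by (rule app[OF x, symmetric])
    finally show "hinf_apply (blinfun_power (composition_operator \<phi>) (Suc n) f) x
        = hinf_apply (composition_operator (\<phi> ^^ Suc n) f) x" .
  qed
qed

text \<open>Every \<open>f\<close> has oscillation at most \<open>2 \<parallel>f\<parallel>\<close>, and \<open>f a = f (\<phi>\<^sup>n a)\<close>.\<close>

lemma norm_composition_operator_diff_le:
  fixes \<phi> :: "'a :: complex_hilbert_space \<Rightarrow> 'a"
  assumes \<phi>: "frechet_holomorphic_on \<phi> (ball 0 1)" "\<phi> ` ball 0 1 \<subseteq> ball 0 1"
    and r: "0 \<le> r" "r < 1" and dil: "\<phi> ` ball 0 1 \<subseteq> (\<lambda>x. r *\<^sub>R x) ` ball 0 1"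
    and a: "a \<in> ball 0 1" "\<phi> a = a"
  shows "norm (composition_operator (\<phi> ^^ n) - composition_operator (\<lambda>_. a)) \<le> 2 * r ^ n"
proof (rule norm_blinfun_bound)
  show "0 \<le> 2 * r ^ n"
    using r by simp
  fix f :: "'a hinf"
  have self: "(\<phi> ^^ n) ` ball 0 1 \<subseteq> ball 0 1" "(\<lambda>_. a) ` ball 0 1 \<subseteq> ball 0 1"
    using funpow_in_invariant_set[OF \<phi>(2)] a(1) by blast+
  note app = composition_operator_apply[OF frechet_holomorphic_on_funpow[OF \<phi>] self(1)]
    composition_operator_apply[OF frechet_holomorphic_on_const self(2)]
  have osc: "cmod (hinf_apply f x - hinf_apply f y) \<le> 2 * norm f"
    if "x \<in> ball 0 1" "y \<in> ball 0 1" for x y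
    using that[THEN hinf_norm_bound[of _ f]]
      norm_triangle_ineq4[of "hinf_apply f x" "hinf_apply f y"] by linarith
  have diff: "hinf_apply (g - h) x = hinf_apply g x - hinf_apply h x" for g h :: "'a hinf" and x
    by (simp add: minus_hinf_def uminus_hinf_def plus_hinf.rep_eq scaleC_hinf.rep_eq)
  show "norm ((composition_operator (\<phi> ^^ n) - composition_operator (\<lambda>_. a)) f)
      \<le> 2 * r ^ n * norm f"
  proof (rule hinf_norm_least)
    fix x :: 'a assume x: "x \<in> ball 0 1"
    from oscillation_funpow[OF hinf_holomorphic osc \<phi> r dil x a(1), of n]
    show "cmod (hinf_apply ((composition_operator (\<phi> ^^ n) - composition_operator (\<lambda>_. a)) f) x)
        \<le> 2 * r ^ n * norm f"
      using x by (simp add: blinfun.diff_left diff app funpow_fixpoint[of \<phi>, OF a(2)] mult_ac del: mem_ball mem_ball_0)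
  qed
qed

text \<open>The errors \<open>X k - L\<close> have a sum bounded by \<open>C / (1 - r)\<close>, which division by \<open>n\<close> sends
  to \<open>0\<close>.\<close>

lemma Cesaro_tendsto_geometric:
  fixes X :: "nat \<Rightarrow> 'a :: real_normed_vector"
  assumes r: "0 \<le> r" "r < 1" and le: "\<And>k. norm (X k - L) \<le> C * r ^ k"
  shows "(\<lambda>n. (1 / real n) *\<^sub>R (\<Sum>k<n. X k)) \<longlonglongrightarrow> L"
proof (rule Lim_transform2[where f = "\<lambda>_. L"])
  have C: "0 \<le> C"
    using order_trans[OF norm_ge_zero le[of 0]] by simp
  have "norm (L - (1 / real n) *\<^sub>R (\<Sum>k<n. X k)) \<le> C / (1 - r) * (1 / real n)" if "n > 0" for n
  proof -
    have "L - (1 / real n) *\<^sub>R (\<Sum>k<n. X k) = - (1 / real n) *\<^sub>R (\<Sum>k<n. X k - L)"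
      using that by (simp add: sum_subtractf scaleR_right_diff_distrib
          scaleR_conv_of_real sum_constant_scaleR)
    also have "norm \<dots> = (1 / real n) * norm (\<Sum>k<n. X k - L)"
      by simp
    also have "norm (\<Sum>k<n. X k - L) \<le> (\<Sum>k<n. C * r ^ k)"
      by (intro sum_norm_le le)
    also have "\<dots> = C * ((1 - r ^ n) / (1 - r))"
      using r by (simp add: sum_gp_strict flip: sum_distrib_left)
    also have "\<dots> \<le> C / (1 - r)"
      using r C by (simp add: divide_right_mono mult_left_le)
    finally show ?thesis
      by (simp add: mult.commute divide_right_mono)
  qed
  then have "\<forall>\<^sub>F n in sequentially.
      norm (L - (1 / real n) *\<^sub>R (\<Sum>k<n. X k)) \<le> C / (1 - r) * (1 / real n)"
    by (intro eventually_sequentiallyI[of 1]) simp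
  then show "(\<lambda>n. L - (1 / real n) *\<^sub>R (\<Sum>k<n. X k)) \<longlonglongrightarrow> 0"
    by (rule Lim_null_comparison) (rule tendsto_mult_right_zero[OF lim_1_over_n])
qed simp

theorem proposition6p2:
  fixes \<phi> :: "'a::complex_hilbert_space \<Rightarrow> 'a" and r :: real
  assumes "frechet_holomorphic_on \<phi> (ball 0 1)"
    and "\<phi> ` ball 0 1 \<subseteq> ball 0 1"
    and "0 < r" and "r < 1"
    and "\<phi> ` ball 0 1 \<subseteq> (\<lambda>x. r *\<^sub>R x) ` ball 0 1"
  shows "(\<exists>!a. a \<in> ball 0 1 \<and> \<phi> a = a) \<and>
    (\<forall>a\<in>ball 0 1. \<phi> a = a \<longrightarrow>
      (\<lambda>n. composition_operator (\<phi> ^^ n)) \<longlonglongrightarrow> composition_operator (\<lambda>_. a) \<and>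
      cesaro_mean (composition_operator \<phi>) \<longlonglongrightarrow> composition_operator (\<lambda>_. a)) \<and>
    uniformly_mean_ergodic (composition_operator \<phi>)"
proof -
  have r: "0 \<le> r"
    using assms(3) by simp
  note hyps = assms(1,2) r assms(4,5)
  have ex1: "\<exists>!a. a \<in> ball 0 1 \<and> \<phi> a = a"
    by (rule ex1_fixed_point[OF hyps])
  have powers: "(\<lambda>n. composition_operator (\<phi> ^^ n)) \<longlonglongrightarrow> composition_operator (\<lambda>_. a)"
    and means: "cesaro_mean (composition_operator \<phi>) \<longlonglongrightarrow> composition_operator (\<lambda>_. a)"
    if "a \<in> ball 0 1" "\<phi> a = a" for a
  proof -
    note le = norm_composition_operator_diff_le[OF hyps that]
    have "(\<lambda>n. 2 * r ^ n) \<longlonglongrightarrow> 0"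
      using tendsto_mult_right_zero[OF LIMSEQ_power_zero[of r]] r assms(4) by simp
    then show "(\<lambda>n. composition_operator (\<phi> ^^ n)) \<longlonglongrightarrow> composition_operator (\<lambda>_. a)"
      by (rule LIM_zero_cancel[OF Lim_null_comparison[OF always_eventually[OF allI[OF le]]]])
    show "cesaro_mean (composition_operator \<phi>) \<longlonglongrightarrow> composition_operator (\<lambda>_. a)"
      using Cesaro_tendsto_geometric[OF r assms(4) le]
      by (simp add: cesaro_mean_def[abs_def] blinfun_power_composition_operator[OF assms(1,2)])
  qed
  obtain a where a: "a \<in> ball 0 1" "\<phi> a = a"
    using ex1 by blast
  have "composition_operator (\<lambda>_. a) \<in> complex_operators"
    using a(1) by (intro composition_operator_complex frechet_holomorphic_on_const) auto
  with means[OF a] have "uniformly_mean_ergodic (composition_operator \<phi>)"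
    unfolding uniformly_mean_ergodic_def
    using composition_operator_complex[OF assms(1,2)] by blast
  with ex1 powers means show ?thesis
    by blast
qed

end
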